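(* (Progress.) Let $N\parallel\mathcal M$ be a network with queue that is typable, i.e. $\vdash N\parallel\mathcal M:G\parallel\mathcal M$ for some well-formed asynchronous type $G\parallel\mathcal M$. Then: (1) if $p[P]\in N$, then $N\parallel\mathcal M\xrightarrow{\tau\cdot\beta}N'\parallel\mathcal M'$ for some sequence of communications $\tau$, some communication $\beta$ with $\mathrm{play}(\beta)=\{p\}$, and some $N',\mathcal M'$; (2) if $\mathcal M\equiv(p,\ell,q)\cdot\mathcal M_1$, then $N\parallel\mathcal M\xrightarrow{\tau\cdot pq?\ell}N'\parallel\mathcal M'$ for some $\tau,N',\mathcal M'$.
   Context: Participants $p,q,r,s$; labels $\ell$. An action is $p!\ell$ or $p?\ell$. Processes are regular (finitely many distinct subterms), possibly infinite terms coinductively generated by $P::=\bigoplus_{i\in I}q!\ell_i;P_i\mid\sum_{i\in I}q?\ell_i;P_i\mid\mathbf 0$ ($I$ finite non-empty, $\ell_i$ pairwise distinct). A message is $(p,\ell,q)$ (sender $p$, receiver $q$); a queue $\mathcal M$ is a finite sequence of messages ($\emptyset$ empty, $\cdot$ concatenation) modulo the least equivalence $\equiv$ allowing adjacent $(p,\ell,q),(r,\ell',s)$ to be swapped when $p\ne r$ or $q\ne s$. A network $N=p_1[P_1]\parallel\cdots\parallel p_n[P_n]$ has pairwise distinct participants, parallel composition being associative, commutative with neutral element $p[\mathbf 0]$; $p[P]\in N$ means $P\neq\mathbf 0$ and $N\equiv p[P]\parallel N'$ for some $N'$. A communication $\beta$ is $pq!\ell$ or $pq?\ell$, $\mathrm{play}(pq!\ell)=\{p\}$,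 $\mathrm{play}(pq?\ell)=\{q\}$; $\xrightarrow{\tau}$ for a finite sequence $\tau$ of communications is the corresponding sequence of steps. Network LTS: $p[\bigoplus_{i\in I}q!\ell_i;P_i]\parallel N\parallel\mathcal M\xrightarrow{pq!\ell_k}p[P_k]\parallel N\parallel\mathcal M\cdot(p,\ell_k,q)$ ($k\in I$); $q[\sum_{j\in J}p?\ell_j;Q_j]\parallel N\parallel(p,\ell_k,q)\cdot\mathcal M\xrightarrow{pq?\ell_k}q[Q_k]\parallel N\parallel\mathcal M$ ($k\in J$). Global types: regular terms coinductively generated by $G::=\boxplus_{i\in I}pq!\ell_i;G_i\mid pq?\ell;G\mid\mathsf{End}$; asynchronous types are pairs $G\parallel\mathcal M$. $\mathrm{play}(G)$: least set with $\mathrm{play}(\boxplus_i pq!\ell_i;G_i)=\{p\}\cup\bigcup_i\mathrm{play}(G_i)$, $\mathrm{play}(pq?\ell;G)=\{q\}\cup\mathrm{play}(G)$, $\mathrm{play}(\mathsf{End})=\emptyset$ (extended to sequences by union). $\mathrm{Tr}(G)$: sequences of communications read along paths from the root to an edge of the tree of $G$. $G$ is cyclic if its tree contains itself as a proper subtree. Projection $G\upharpoonright r$ (partial, coinductive; $\vec\pi$ possibly empty sequence of actions): $\mathbf 0$ if $r\notin\mathrm{play}(G)$; $(\boxplus_{i\in I}pq!\ell_i;G_i)\upharpoonright r$ is $\bigoplus_{i}q!\ell_i;(G_i\upharpoonright p)$ if $r=p$; $G_1\upharpoonright q$ if $r=q$, $I=\{1\}$; $\vec\pi;\sum_i p?\ell_i;P_i$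 if $r=q$, $|I|>1$, $G_i\upharpoonright q=\vec\pi;p?\ell_i;P_i$ for all $i$; $G_1\upharpoonright r$ if $r\notin\{p,q\}$, $r\in\mathrm{play}(G_1)$, $G_i\upharpoonright r=G_1\upharpoonright r$ for all $i$; $(pq?\ell;G)\upharpoonright r$ is $p?\ell;(G\upharpoonright r)$ if $r=q$, $G\upharpoonright r$ if $r\neq q$ and $r\in\mathrm{play}(G)$; undefined otherwise. Depth: $\mathrm{ord}(\tau,p)=n$ if $\tau=\tau_1\cdot\beta\cdot\tau_2$, $|\tau_1|=n-1$, $p\notin\mathrm{play}(\tau_1)$, $p\in\mathrm{play}(\beta)$, else $0$; $\mathrm{depth}(G,p)=\sup\{\mathrm{ord}(\tau,p)\mid\tau\in\mathrm{Tr}(G)\}$ if $p\in\mathrm{play}(G)$, else $0$; $G$ bounded if $\mathrm{depth}(G',p)<\infty$ for all subtrees $G'$ and all $p$. Balancing: $\vdash G\parallel\mathcal M$ if derivable by a possibly infinite derivation from: $\vdash\mathsf{End}\parallel\emptyset$; $\vdash G\parallel\mathcal M$ gives $\vdash pq?\ell;G\parallel(p,\ell,q)\cdot\mathcal M$; $\vdash G_i\parallel\mathcal M\cdot(p,\ell_i,q)$ for all $i\in I$ gives $\vdash\boxplus_{i\in I}pq!\ell_i;G_i\parallel\mathcal M$ provided $\mathcal M=\emptyset$ if that global type is cyclic. Well formed: balanced, all projections defined, $G$ bounded. Preorder $\le$: largest relation with $P\le Q$ implying $P=Q=\mathbf 0$, or $P=\bigoplus_{i\in I}p!\ell_i;P_i$,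 $Q=\bigoplus_{i\in I}p!\ell_i;Q_i$, $P_i\le Q_i$; or $P=\sum_{i\in I\cup J}p?\ell_i;P_i$, $Q=\sum_{i\in I}p?\ell_i;Q_i$, $P_i\le Q_i$ ($i\in I$). Typing: for well-formed $G\parallel\mathcal M$, $\vdash N\parallel\mathcal M:G\parallel\mathcal M$ iff $N=\prod_{i\in I}p_i[P_i]$, $P_i\le G\upharpoonright p_i$ for all $i$, $\mathrm{play}(G)\subseteq\{p_i\mid i\in I\}$. *)

theory Defs
  imports "HOL-Library.Finite_Map" "HOL-Library.Extended_Nat"
begin

text \<open>
  An indexed choice over pairwise distinct labels is a finite map from labels to continuations;
  terms are therefore identified up to reordering of branches. Non-emptiness of choices and
  regularity are imposed by the predicate \<open>process\<close> below.
\<close>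

codatatype (dead 'p, dead 'l) proc =
    Inact
  | Out 'p "('l, ('p, 'l) proc) fmap"
  | Inp 'p "('l, ('p, 'l) proc) fmap"

abbreviation fmsingle :: "'a \<Rightarrow> 'b \<Rightarrow> ('a, 'b) fmap" where
  "fmsingle a b \<equiv> fmupd a b fmempty"

inductive pchild :: "('p, 'l) proc \<Rightarrow> ('p, 'l) proc \<Rightarrow> bool" where
  "fmlookup B l = Some P \<Longrightarrow> pchild (Out q B) P"
| "fmlookup B l = Some P \<Longrightarrow> pchild (Inp q B) P"

definition subprocs :: "('p, 'l) proc \<Rightarrow> ('p, 'l) proc set" where
  "subprocs P = {P'. pchild\<^sup>*\<^sup>* P P'}"

definition process :: "('p, 'l) proc \<Rightarrow> bool" where
  "process P \<longleftrightarrow> finite (subprocs P) \<and>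
     (\<forall>q B. Out q B \<in> subprocs P \<longrightarrow> B \<noteq> fmempty) \<and>
     (\<forall>q B. Inp q B \<in> subprocs P \<longrightarrow> B \<noteq> fmempty)"

datatype ('p, 'l) action = AOut 'p 'l | AInp 'p 'l

fun prefix1 :: "('p, 'l) action \<Rightarrow> ('p, 'l) proc \<Rightarrow> ('p, 'l) proc" where
  "prefix1 (AOut q l) P = Out q (fmsingle l P)"
| "prefix1 (AInp q l) P = Inp q (fmsingle l P)"

definition prefixes :: "('p, 'l) action list \<Rightarrow> ('p, 'l) proc \<Rightarrow> ('p, 'l) proc" where
  "prefixes \<pi> P = foldr prefix1 \<pi> P"

coinductive proc_le :: "('p, 'l) proc \<Rightarrow> ('p, 'l) proc \<Rightarrow> bool" (infix "\<preceq>" 50) where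
  le_inact: "Inact \<preceq> Inact"
| le_out: "fmdom B = fmdom C \<Longrightarrow>
    (\<forall>l P Q. fmlookup B l = Some P \<longrightarrow> fmlookup C l = Some Q \<longrightarrow> P \<preceq> Q) \<Longrightarrow>
    Out p B \<preceq> Out p C"
| le_inp: "fmdom C |\<subseteq>| fmdom B \<Longrightarrow>
    (\<forall>l P Q. fmlookup B l = Some P \<longrightarrow> fmlookup C l = Some Q \<longrightarrow> P \<preceq> Q) \<Longrightarrow>
    Inp p B \<preceq> Inp p C"

text \<open>A message is a triple of sender, label and receiver.\<close>

type_synonym ('p, 'l) msg = "'p \<times> 'l \<times> 'p"

inductive queue_equiv :: "('p, 'l) msg list \<Rightarrow> ('p, 'l) msg list \<Rightarrow> bool" where
  qe_refl: "queue_equiv ms ms"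
| qe_sym: "queue_equiv ms ns \<Longrightarrow> queue_equiv ns ms"
| qe_trans: "queue_equiv ms ns \<Longrightarrow> queue_equiv ns ks \<Longrightarrow> queue_equiv ms ks"
| qe_swap: "p \<noteq> r \<or> q \<noteq> s \<Longrightarrow>
    queue_equiv (ms @ [(p, l, q), (r, l', s)] @ ns) (ms @ [(r, l', s), (p, l, q)] @ ns)"

text \<open>Queues are lists modulo \<open>queue_equiv\<close>, so equality of queues is the equivalence of lists.\<close>

quotient_type ('p, 'l) queue = "('p, 'l) msg list" / queue_equiv
  by (rule equivpI; unfold reflp_def symp_def transp_def)
    (blast intro: qe_refl qe_sym qe_trans)+

lemma queue_equiv_app_left: "queue_equiv ms ns \<Longrightarrow> queue_equiv (ks @ ms) (ks @ ns)"
proof (induction rule: queue_equiv.induct)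
  case (qe_swap p r q s ms l l' ns)
  then show ?case
    using queue_equiv.qe_swap[of p r q s "ks @ ms" l l' ns] by simp
qed (blast intro: qe_refl qe_sym qe_trans)+

lemma queue_equiv_app_right: "queue_equiv ms ns \<Longrightarrow> queue_equiv (ms @ ks) (ns @ ks)"
proof (induction rule: queue_equiv.induct)
  case (qe_swap p r q s ms l l' ns)
  then show ?case
    using queue_equiv.qe_swap[of p r q s ms l l' "ns @ ks"] by simp
qed (blast intro: qe_refl qe_sym qe_trans)+

lift_definition qempty :: "('p, 'l) queue" is "[]" .

lift_definition qmsg :: "'p \<Rightarrow> 'l \<Rightarrow> 'p \<Rightarrow> ('p, 'l) queue" is "\<lambda>p l q. [(p, l, q)]" .

lift_definition qappend :: "('p, 'l) queue \<Rightarrow> ('p, 'l) queue \<Rightarrow> ('p, 'l) queue"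
  (infixr "\<cdot>" 65) is "(@)"
  by (blast intro: qe_trans queue_equiv_app_left queue_equiv_app_right)

text \<open>
  Participants in a network are pairwise distinct and \<open>p[0]\<close> is neutral for the associative and
  commutative parallel composition. So a network up to structural congruence is a finitely
  supported function: participant \<open>p\<close> is mapped to the process it runs, and to \<open>Inact\<close> if it does
  not occur.
\<close>

type_synonym ('p, 'l) net = "'p \<Rightarrow> ('p, 'l) proc"

definition network :: "('p, 'l) net \<Rightarrow> bool" where
  "network N \<longleftrightarrow> finite {p. N p \<noteq> Inact} \<and> (\<forall>p. process (N p))"

definition in_net :: "'p \<Rightarrow> ('p, 'l) proc \<Rightarrow> ('p, 'l) net \<Rightarrow> bool" where
  "in_net p P N \<longleftrightarrow> P \<noteq> Inact \<and> (\<exists>N'. network N' \<and> N' p = Inact \<and> N = N'(p := P))"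

text \<open>In \<open>Send p q l\<close> and \<open>Recv p q l\<close>, the sender is \<open>p\<close> and the receiver is \<open>q\<close>.\<close>

datatype ('p, 'l) comm = Send 'p 'p 'l | Recv 'p 'p 'l

fun comm_play :: "('p, 'l) comm \<Rightarrow> 'p set" where
  "comm_play (Send p q l) = {p}"
| "comm_play (Recv p q l) = {q}"

definition trace_play :: "('p, 'l) comm list \<Rightarrow> 'p set" where
  "trace_play \<tau> = (\<Union>\<beta>\<in>set \<tau>. comm_play \<beta>)"

inductive step ::
  "('p, 'l) net \<times> ('p, 'l) queue \<Rightarrow> ('p, 'l) comm \<Rightarrow> ('p, 'l) net \<times> ('p, 'l) queue \<Rightarrow> bool"
where
  step_send: "N p = Out q B \<Longrightarrow> fmlookup B l = Some P \<Longrightarrow>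
    step (N, M) (Send p q l) (N(p := P), M \<cdot> qmsg p l q)"
| step_recv: "N q = Inp p B \<Longrightarrow> fmlookup B l = Some Q \<Longrightarrow>
    step (N, qmsg p l q \<cdot> M) (Recv p q l) (N(q := Q), M)"

inductive steps ::
  "('p, 'l) net \<times> ('p, 'l) queue \<Rightarrow> ('p, 'l) comm list \<Rightarrow> ('p, 'l) net \<times> ('p, 'l) queue \<Rightarrow> bool"
where
  steps_nil: "steps c [] c"
| steps_cons: "step c \<beta> c' \<Longrightarrow> steps c' \<tau> c'' \<Longrightarrow> steps c (\<beta> # \<tau>) c''"

codatatype (dead 'p, dead 'l) gtype =
    End
  | GOut 'p 'p "('l, ('p, 'l) gtype) fmap"
  | GInp 'p 'p 'l "('p, 'l) gtype"

inductive gedge :: "('p, 'l) gtype \<Rightarrow> ('p, 'l) comm \<Rightarrow> ('p, 'l) gtype \<Rightarrow> bool" where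
  "fmlookup B l = Some G \<Longrightarrow> gedge (GOut p q B) (Send p q l) G"
| "gedge (GInp p q l G) (Recv p q l) G"

definition gchild :: "('p, 'l) gtype \<Rightarrow> ('p, 'l) gtype \<Rightarrow> bool" where
  "gchild G G' \<longleftrightarrow> (\<exists>\<beta>. gedge G \<beta> G')"

definition subtrees :: "('p, 'l) gtype \<Rightarrow> ('p, 'l) gtype set" where
  "subtrees G = {G'. gchild\<^sup>*\<^sup>* G G'}"

definition proper_subtrees :: "('p, 'l) gtype \<Rightarrow> ('p, 'l) gtype set" where
  "proper_subtrees G = {G'. gchild\<^sup>+\<^sup>+ G G'}"

definition global_type :: "('p, 'l) gtype \<Rightarrow> bool" where
  "global_type G \<longleftrightarrow> finite (subtrees G) \<and>
     (\<forall>p q B. GOut p q B \<in> subtrees G \<longrightarrow> B \<noteq> fmempty)"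

definition cyclic :: "('p, 'l) gtype \<Rightarrow> bool" where
  "cyclic G \<longleftrightarrow> G \<in> proper_subtrees G"

inductive in_play :: "'p \<Rightarrow> ('p, 'l) gtype \<Rightarrow> bool" where
  "in_play p (GOut p q B)"
| "fmlookup B l = Some G \<Longrightarrow> in_play r G \<Longrightarrow> in_play r (GOut p q B)"
| "in_play q (GInp p q l G)"
| "in_play r G \<Longrightarrow> in_play r (GInp p q l G)"

definition play :: "('p, 'l) gtype \<Rightarrow> 'p set" where
  "play G = {r. in_play r G}"

inductive is_trace :: "('p, 'l) gtype \<Rightarrow> ('p, 'l) comm list \<Rightarrow> bool" where
  "gedge G \<beta> G' \<Longrightarrow> is_trace G [\<beta>]"
| "gedge G \<beta> G' \<Longrightarrow> is_trace G' \<tau> \<Longrightarrow> is_trace G (\<beta> # \<tau>)"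

definition Tr :: "('p, 'l) gtype \<Rightarrow> ('p, 'l) comm list set" where
  "Tr G = {\<tau>. is_trace G \<tau>}"

text \<open>
  Projection is a partial function, rendered as a coinductive relation. The first case takes
  precedence: without the guards \<open>q \<in> play \<dots>\<close> in the two receiver cases the greatest relation
  would also project some types in which \<open>q\<close> does not occur to processes other than \<open>Inact\<close>. Likewise
  the sender case takes precedence over the receiver cases, hence \<open>p \<noteq> q\<close> there; this only matters
  if a participant sends to itself.
\<close>

coinductive proj :: "('p, 'l) gtype \<Rightarrow> 'p \<Rightarrow> ('p, 'l) proc \<Rightarrow> bool" where
  proj_notin: "r \<notin> play G \<Longrightarrow> proj G r Inact"
| proj_sender: "fmdom B = fmdom C \<Longrightarrow>
    (\<forall>l G P. fmlookup B l = Some G \<longrightarrow> fmlookup C l = Some P \<longrightarrow> proj G p P) \<Longrightarrow>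
    proj (GOut p q B) p (Out q C)"
| proj_receiver_single: "p \<noteq> q \<Longrightarrow> q \<in> play (GOut p q B) \<Longrightarrow> B = fmsingle l G \<Longrightarrow>
    proj G q P \<Longrightarrow>
    proj (GOut p q B) q P"
| proj_receiver_branch: "p \<noteq> q \<Longrightarrow> q \<in> play (GOut p q B) \<Longrightarrow> fcard (fmdom B) > 1 \<Longrightarrow>
    fmdom B = fmdom C \<Longrightarrow>
    (\<forall>l G P. fmlookup B l = Some G \<longrightarrow> fmlookup C l = Some P \<longrightarrow>
       proj G q (prefixes \<pi> (Inp p (fmsingle l P)))) \<Longrightarrow>
    proj (GOut p q B) q (prefixes \<pi> (Inp p C))"
| proj_out_other: "r \<notin> {p, q} \<Longrightarrow> fmlookup B l\<^sub>1 = Some G\<^sub>1 \<Longrightarrow> r \<in> play G\<^sub>1 \<Longrightarrow>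
    (\<forall>l G. fmlookup B l = Some G \<longrightarrow> proj G r P) \<Longrightarrow>
    proj (GOut p q B) r P"
| proj_inp_receiver: "proj G q P \<Longrightarrow> proj (GInp p q l G) q (Inp p (fmsingle l P))"
| proj_inp_other: "r \<noteq> q \<Longrightarrow> r \<in> play G \<Longrightarrow> proj G r P \<Longrightarrow> proj (GInp p q l G) r P"

definition trace_ord :: "('p, 'l) comm list \<Rightarrow> 'p \<Rightarrow> nat" where
  "trace_ord \<tau> p =
     (if \<exists>n \<tau>\<^sub>1 \<beta> \<tau>\<^sub>2. \<tau> = \<tau>\<^sub>1 @ [\<beta>] @ \<tau>\<^sub>2 \<and> n = length \<tau>\<^sub>1 + 1 \<and>
           p \<notin> trace_play \<tau>\<^sub>1 \<and> p \<in> comm_play \<beta>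
      then THE n. \<exists>\<tau>\<^sub>1 \<beta> \<tau>\<^sub>2. \<tau> = \<tau>\<^sub>1 @ [\<beta>] @ \<tau>\<^sub>2 \<and> n = length \<tau>\<^sub>1 + 1 \<and>
           p \<notin> trace_play \<tau>\<^sub>1 \<and> p \<in> comm_play \<beta>
      else 0)"

definition depth :: "('p, 'l) gtype \<Rightarrow> 'p \<Rightarrow> enat" where
  "depth G p = (if p \<in> play G then SUP \<tau>\<in>Tr G. enat (trace_ord \<tau> p) else 0)"

definition bounded_gtype :: "('p, 'l) gtype \<Rightarrow> bool" where
  "bounded_gtype G \<longleftrightarrow> (\<forall>G'\<in>subtrees G. \<forall>p. depth G' p < \<infinity>)"

coinductive balanced :: "('p, 'l) gtype \<Rightarrow> ('p, 'l) queue \<Rightarrow> bool" where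
  bal_end: "balanced End qempty"
| bal_inp: "balanced G M \<Longrightarrow> balanced (GInp p q l G) (qmsg p l q \<cdot> M)"
| bal_out: "(\<forall>l G. fmlookup B l = Some G \<longrightarrow> balanced G (M \<cdot> qmsg p l q)) \<Longrightarrow>
    (cyclic (GOut p q B) \<longrightarrow> M = qempty) \<Longrightarrow>
    balanced (GOut p q B) M"

definition well_formed :: "('p, 'l) gtype \<Rightarrow> ('p, 'l) queue \<Rightarrow> bool" where
  "well_formed G M \<longleftrightarrow> global_type G \<and> balanced G M \<and>
     (\<forall>r. \<exists>P. process P \<and> proj G r P) \<and> bounded_gtype G"

text \<open>
  \<open>typed N M G\<close> is the judgement \<open>\<turnstile> N \<parallel> M : G \<parallel> M\<close>. The set \<open>I\<close> contains the
  participants of a presentation of \<open>N\<close> as a product; it may include some that run \<open>Inact\<close>.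
\<close>

definition typed :: "('p, 'l) net \<Rightarrow> ('p, 'l) queue \<Rightarrow> ('p, 'l) gtype \<Rightarrow> bool" where
  "typed N M G \<longleftrightarrow> network N \<and> well_formed G M \<and>
     (\<exists>I. finite I \<and> (\<forall>p. p \<notin> I \<longrightarrow> N p = Inact) \<and>
        (\<forall>p\<in>I. \<exists>Q. process Q \<and> proj G p Q \<and> N p \<preceq> Q) \<and>
        play G \<subseteq> I)"

end

theory Submission
  imports Defs
begin

text \<open>
  A network conforming to a type can perform every communication offered at the root of the type
  and then conforms to the corresponding subtree, so it can follow any path of the tree of the
  type. A participant with a non-inert process occurs in the type, and following a path that
  leads to one of its communications gives the first claim. For the second claim every path will
  do: as long as the message stays in the queue no cyclic choice of outputs can be at the root,
  since balancing requires an empty queue there. So each step either leaves a subtree for good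
  (non-cyclic root, finitely many subtrees by regularity) or consumes some message (cyclic input),
  and the message must be read.
\<close>

section \<open>Finite maps and the preorder on processes\<close>

lemma fmlookup_fmdom_mono:
  assumes "fmlookup B l = Some x" "fmdom B |\<subseteq>| fmdom C"
  obtains y where "fmlookup C l = Some y"
proof -
  have "l |\<in>| fmdom B" using assms(1) by (rule fmdomI)
  then show ?thesis using assms(2) that by (meson fmlookup_dom_iff fsubsetD)
qed

lemma proc_le_refl: "P \<preceq> P"
proof (coinduction arbitrary: P)
  case proc_le
  then show ?case by (cases P) auto
qed

lemma proc_le_trans: "P \<preceq> Q \<Longrightarrow> Q \<preceq> R \<Longrightarrow> P \<preceq> R"
proof (coinduction arbitrary: P Q R)
  case proc_le
  from proc_le(1) show ?case
  proof cases
    case le_inact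
    then show ?thesis using proc_le(2) by (auto elim: proc_le.cases)
  next
    case (le_out B C p)
    from proc_le(2) le_out(2) obtain D where D: "R = Out p D" "fmdom C = fmdom D"
      "\<forall>l P Q. fmlookup C l = Some P \<longrightarrow> fmlookup D l = Some Q \<longrightarrow> P \<preceq> Q"
      by (auto elim: proc_le.cases)
    \<comment> \<open>The coinduction hypothesis asks for an intermediate process. It is the
      continuation at \<open>l\<close> of the middle process, which offers \<open>l\<close> because
      the preorder makes the labels of \<open>D\<close> labels of \<open>C\<close>.\<close>
    have "\<exists>X. P' \<preceq> X \<and> X \<preceq> R'" if "fmlookup B l = Some P'" "fmlookup D l = Some R'" for l P' R'
    proof -
      from that(2) D(2) obtain X where "fmlookup C l = Some X" by (auto elim: fmlookup_fmdom_mono)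
      then show ?thesis using that le_out(4) D(3) by blast
    qed
    then show ?thesis using le_out D by auto
  next
    case (le_inp C B p)
    from proc_le(2) le_inp(2) obtain D where D: "R = Inp p D" "fmdom D |\<subseteq>| fmdom C"
      "\<forall>l P Q. fmlookup C l = Some P \<longrightarrow> fmlookup D l = Some Q \<longrightarrow> P \<preceq> Q"
      by (auto elim: proc_le.cases)
    have "\<exists>X. P' \<preceq> X \<and> X \<preceq> R'" if "fmlookup B l = Some P'" "fmlookup D l = Some R'" for l P' R'
    proof -
      from that(2) D(2) obtain X where "fmlookup C l = Some X"
        by (rule fmlookup_fmdom_mono)
      then show ?thesis using that le_inp(4) D(3) by blast
    qed
    then show ?thesis using le_inp D by auto
  qed
qed

lemma prefixes_mono: "P \<preceq> Q \<Longrightarrow> prefixes \<pi> P \<preceq> prefixes \<pi> Q"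
proof (induction \<pi>)
  case (Cons a \<pi>)
  then show ?case
    by (cases a) (auto simp: prefixes_def intro!: proc_le.intros split: if_splits)
qed (simp add: prefixes_def)

text \<open>An input with more labels is smaller in the preorder. This compares the full choice that
  a receiver gets from a branching output with the single-label input in the projection of one
  branch.\<close>

lemma prefixes_Inp_le_single:
  assumes "fmlookup C l = Some P"
  shows "prefixes \<pi> (Inp p C) \<preceq> prefixes \<pi> (Inp p (fmsingle l P))"
  using assms by (intro prefixes_mono le_inp) (auto simp: fmlookup_dom_iff proc_le_refl split: if_splits)

text \<open>Up to \<open>queue_equiv\<close>, a queue is determined by its channels, i.e. by the subsequences of the
  messages with a given sender and a given receiver.\<close>

lift_definition channel :: "'p \<Rightarrow> 'p \<Rightarrow> ('p, 'l) queue \<Rightarrow> ('p, 'l) msg list"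
  is "\<lambda>p q. filter (\<lambda>(r, _, s). r = p \<and> s = q)"
  subgoal for p q ms ns
    by (induction rule: queue_equiv.induct) auto
  done

lift_definition qlength :: "('p, 'l) queue \<Rightarrow> nat" is length
  subgoal for ms ns
    by (induction rule: queue_equiv.induct) auto
  done

lemma channel_append: "channel p q (M \<cdot> M') = channel p q M @ channel p q M'"
  by transfer simp

lemma channel_msg: "channel p q (qmsg r l s) = (if r = p \<and> s = q then [(r, l, s)] else [])"
  by transfer simp

lemma qlength_msg_append: "qlength (qmsg p l q \<cdot> M) = Suc (qlength M)"
  by transfer simp

lemma qappend_assoc: "(M \<cdot> M') \<cdot> M'' = M \<cdot> M' \<cdot> M''"
  by transfer (simp add: qe_refl)

lemma qmsg_append_neq_qempty: "qmsg p l q \<cdot> M \<noteq> qempty"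
proof
  assume "qmsg p l q \<cdot> M = qempty"
  then have "channel p q qempty = (p, l, q) # channel p q M"
    using channel_append[of p q "qmsg p l q" M] by (simp add: channel_msg)
  moreover have "channel p q qempty = ([] :: ('a, 'b) msg list)" by transfer simp
  ultimately show False by simp
qed

lemma queue_equiv_Cons_swap:
  "r \<noteq> p \<or> s \<noteq> q \<Longrightarrow> queue_equiv ((r, k, s) # (p, l, q) # ms) ((p, l, q) # (r, k, s) # ms)"
  using qe_swap[of r p s q "[]" k l ms] by simp

text \<open>All messages ahead of the first one from \<open>p\<close> to \<open>q\<close> travel on
  other channels, so it can be swapped past them to the front.\<close>

lemma queue_equiv_head:
  assumes "filter (\<lambda>(r, _, s). r = p \<and> s = q) ms = (p, l, q) # ks"
  shows "\<exists>ns. queue_equiv ms ((p, l, q) # ns)"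
  using assms
proof (induction ms)
  case (Cons m ms)
  obtain r k s where m: "m = (r, k, s)" by (cases m)
  show ?case
  proof (cases "r = p \<and> s = q")
    case True
    then show ?thesis using Cons.prems m by (auto intro: qe_refl)
  next
    case False
    then obtain ns where "queue_equiv ms ((p, l, q) # ns)" using Cons m by auto
    then have "queue_equiv (m # ms) (m # (p, l, q) # ns)"
      using queue_equiv_app_left[of ms _ "[m]"] by simp
    then show ?thesis using queue_equiv_Cons_swap[of r p s q k l ns] False m qe_trans by blast
  qed
qed simp

lemma channel_ConsD: "channel p q M = (p, l, q) # ks \<Longrightarrow> \<exists>M'. M = qmsg p l q \<cdot> M'"
  by transfer (simp add: queue_equiv_head)

text \<open>The channel from \<open>p\<close> to \<open>q\<close> is the same on both sides. If the
  right-hand head lies on it, the two heads coincide; otherwise that channel of \<open>M'\<close>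
  still starts with \<open>(p, l, q)\<close>.\<close>

lemma two_heads:
  assumes "qmsg p l q \<cdot> M = qmsg r k s \<cdot> M'"
  shows "p = r \<and> q = s \<and> l = k \<or> (\<exists>M''. M' = qmsg p l q \<cdot> M'')"
proof -
  have "channel p q (qmsg p l q \<cdot> M) = channel p q (qmsg r k s \<cdot> M')"
    by (simp add: assms)
  then show ?thesis
    by (auto simp: channel_append channel_msg split: if_splits dest!: channel_ConsD[OF sym])
qed

section \<open>Subtrees of global types and cyclicity\<close>

lemma gchild_GOut: "fmlookup B l = Some G \<Longrightarrow> gchild (GOut p q B) G"
  by (auto simp: gchild_def intro: gedge.intros)

lemma gchild_GInp: "gchild (GInp p q l G) G"
  by (auto simp: gchild_def intro: gedge.intros)

lemma subtrees_gchild: "gchild G G' \<Longrightarrow> subtrees G' \<subseteq> subtrees G"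
  by (auto simp: subtrees_def intro: converse_rtranclp_into_rtranclp)

lemma self_in_subtrees: "G \<in> subtrees G"
  by (simp add: subtrees_def)

lemma cyclic_if_in_subtrees_gchild: "gchild G G' \<Longrightarrow> G \<in> subtrees G' \<Longrightarrow> cyclic G"
  by (auto simp: subtrees_def cyclic_def proper_subtrees_def intro: rtranclp_into_tranclp2)

lemma global_type_gchild: "global_type G \<Longrightarrow> gchild G G' \<Longrightarrow> global_type G'"
  using subtrees_gchild unfolding global_type_def by (blast intro: finite_subset)

lemma global_type_GOut_label:
  assumes "global_type (GOut p q B)"
  obtains l G where "fmlookup B l = Some G"
proof -
  have "B \<noteq> fmempty" using assms self_in_subtrees unfolding global_type_def by blast
  then show ?thesis using that by (metis fmempty_lookup fmap_ext not_Some_eq)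
qed

text \<open>Every subtree of \<open>G'\<close> is one of \<open>G\<close>, and \<open>G\<close>
  itself is lost on the way down unless it recurs below, which is cyclicity.\<close>

lemma card_subtrees_gchild:
  assumes "global_type G" "gchild G G'"
  shows "card (subtrees G') \<le> card (subtrees G)"
    and "\<not> cyclic G \<Longrightarrow> card (subtrees G') < card (subtrees G)"
proof -
  have fin: "finite (subtrees G)" using assms(1) by (simp add: global_type_def)
  then show "card (subtrees G') \<le> card (subtrees G)"
    using subtrees_gchild[OF assms(2)] by (rule card_mono)
  assume "\<not> cyclic G"
  then have "subtrees G' \<subset> subtrees G"
    using subtrees_gchild cyclic_if_in_subtrees_gchild self_in_subtrees assms(2) by blast
  then show "card (subtrees G') < card (subtrees G)" using fin by (rule psubset_card_mono[rotated])
qed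

section \<open>Conformance of networks to types, and its preservation\<close>

definition conforms :: "('p, 'l) net \<Rightarrow> ('p, 'l) queue \<Rightarrow> ('p, 'l) gtype \<Rightarrow> bool" where
  "conforms N M G \<longleftrightarrow>
     global_type G \<and> balanced G M \<and> (\<forall>r. \<exists>Q. proj G r Q \<and> N r \<preceq> Q)"

text \<open>\<open>conforms\<close> is the invariant kept along executions. It quantifies over all
  participants: one outside the index set of \<open>typed\<close> runs \<open>Inact\<close> and, not
  being in \<open>play G\<close>, also projects to \<open>Inact\<close>.\<close>

lemma typed_conforms:
  assumes "typed N M G"
  shows "conforms N M G"
  using assms unfolding typed_def well_formed_def conforms_def
  by (metis le_inact proj_notin subsetD)

lemma play_GOut: "fmlookup B l = Some G \<Longrightarrow> play G \<subseteq> play (GOut p q B)"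
  by (auto simp: play_def intro: in_play.intros(2))

lemma play_GInp: "play G \<subseteq> play (GInp p q l G)"
  by (auto simp: play_def intro: in_play.intros(4))

text \<open>Every rule except \<open>proj_notin\<close> puts \<open>r\<close> into
  \<open>play G\<close>, so a case analysis suffices although \<open>proj\<close> is
  coinductive.\<close>

lemma proj_outside_play:
  assumes "proj G r P" "r \<notin> play G"
  shows "P = Inact"
  using assms(1)
proof cases
  case (proj_sender B C q)
  then show ?thesis using assms(2) in_play.intros(1)[of r q B] by (simp add: play_def)
next
  case (proj_out_other p q B l H)
  then show ?thesis using assms(2) play_GOut[of B l H p q] by blast
next
  case (proj_inp_receiver H Q p l)
  then show ?thesis using assms(2) in_play.intros(3)[of r p l H] by (simp add: play_def)
next
  case (proj_inp_other q H p l)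
  then show ?thesis using assms(2) play_GInp[of H p q l] by blast
qed (use assms(2) in simp_all)

text \<open>The preorder replaces equality because of the receiver of a branching choice: its
  projection joins the inputs of all branches, while that of \<open>G\<close> keeps only the label
  \<open>l\<close>. In the other cases the projection does not change.\<close>

lemma proj_other_GOut:
  assumes "proj (GOut p q B) r Q" "r \<noteq> p" "fmlookup B l = Some G"
  shows "\<exists>Q'. proj G r Q' \<and> Q \<preceq> Q'"
  using assms(1)
proof cases
  case proj_notin
  then have "r \<notin> play G" using play_GOut[OF assms(3)] by blast
  then have "proj G r Inact" by (rule proj.proj_notin)
  then show ?thesis using proj_notin(1) le_inact by blast
next
  case (proj_receiver_single k H)
  have "H = G" using assms(3) unfolding proj_receiver_single(4) by (simp split: if_splits)
  then show ?thesis using proj_receiver_single(1,5) proc_le_refl[of Q] by blast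
next
  case (proj_receiver_branch C \<pi>)
  obtain P where P: "fmlookup C l = Some P"
    using assms(3) proj_receiver_branch(6) by (metis fmlookup_fmdom_mono fsubset_refl)
  then have "proj G r (prefixes \<pi> (Inp p (fmsingle l P)))"
    using assms(3) proj_receiver_branch(7,1) by blast
  then show ?thesis using prefixes_Inp_le_single[OF P] proj_receiver_branch(2) by blast
next
  case (proj_out_other k H)
  then show ?thesis using assms(3) proc_le_refl[of Q] by blast
qed (use assms(2) in simp)

lemma proj_other_GInp:
  assumes "proj (GInp p q l G) r Q" "r \<noteq> q"
  shows "proj G r Q"
  using assms(1)
proof cases
  case proj_notin
  then have "r \<notin> play G" using play_GInp[of G p q l] by blast
  then show ?thesis unfolding proj_notin(1) by (rule proj.proj_notin)
qed (use assms in auto)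

text \<open>Projection and preorder both preserve the label set of an output, so the sender offers
  exactly the labels of the type.\<close>

lemma conforms_GOut_step:
  assumes "conforms N M (GOut p q B)" and l: "fmlookup B l = Some G"
  shows "\<exists>N'. step (N, M) (Send p q l) (N', M \<cdot> qmsg p l q) \<and> conforms N' (M \<cdot> qmsg p l q) G"
proof -
  have gt: "global_type (GOut p q B)" and bal: "balanced (GOut p q B) M"
    and pr: "\<And>r. \<exists>Q. proj (GOut p q B) r Q \<and> N r \<preceq> Q"
    using assms(1) by (auto simp: conforms_def)
  have "p \<in> play (GOut p q B)" by (simp add: play_def in_play.intros)
  with pr[of p] obtain C where C: "fmdom B = fmdom C" "N p \<preceq> Out q C"
    "\<forall>l G P. fmlookup B l = Some G \<longrightarrow> fmlookup C l = Some P \<longrightarrow> proj G p P"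
    by (auto elim: proj.cases)
  from C(2) obtain D where D: "N p = Out q D" "fmdom D = fmdom C"
    "\<forall>l P Q. fmlookup D l = Some P \<longrightarrow> fmlookup C l = Some Q \<longrightarrow> P \<preceq> Q"
    by (auto elim: proc_le.cases)
  from l C(1) D(2) obtain P Q where PQ: "fmlookup D l = Some P" "fmlookup C l = Some Q"
    by (metis fmlookup_fmdom_mono fsubset_refl)
  have "\<exists>Q'. proj G r Q' \<and> (N(p := P)) r \<preceq> Q'" for r
  proof (cases "r = p")
    case True
    then show ?thesis using C(3) D(3) l PQ by (metis fun_upd_same)
  next
    case False
    \<comment> \<open>Passing to the branch may enlarge the projection; transitivity carries the
      bound on \<open>N r\<close> over.\<close>
    then show ?thesis using pr[of r] proj_other_GOut[OF _ False l] proc_le_trans by (metis fun_upd_other)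
  qed
  moreover have "balanced G (M \<cdot> qmsg p l q)" using bal l by (auto elim: balanced.cases)
  ultimately have "conforms (N(p := P)) (M \<cdot> qmsg p l q) G"
    using global_type_gchild[OF gt gchild_GOut[OF l]] by (simp add: conforms_def)
  then show ?thesis using step_send[of N p q D l P M] D(1) PQ(1) by blast
qed

text \<open>Balancing puts the message at the head of the queue, and the preorder only lets the
  process accept additional labels, so \<open>l\<close> is accepted.\<close>

lemma conforms_GInp_step:
  assumes "conforms N M (GInp p q l G)"
  shows "\<exists>N' M'. M = qmsg p l q \<cdot> M' \<and> step (N, M) (Recv p q l) (N', M') \<and> conforms N' M' G"
proof -
  have gt: "global_type (GInp p q l G)" and bal: "balanced (GInp p q l G) M"
    and pr: "\<And>r. \<exists>Q. proj (GInp p q l G) r Q \<and> N r \<preceq> Q"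
    using assms(1) by (auto simp: conforms_def)
  from bal obtain M' where M': "M = qmsg p l q \<cdot> M'" "balanced G M'"
    by (auto elim: balanced.cases)
  have "q \<in> play (GInp p q l G)" by (simp add: play_def in_play.intros)
  with pr[of q] obtain Q where Q: "proj G q Q" "N q \<preceq> Inp p (fmsingle l Q)"
    by (auto elim: proj.cases)
  from Q(2) obtain D P where D: "N q = Inp p D" "fmlookup D l = Some P" "P \<preceq> Q"
    by (auto elim!: proc_le.cases simp: fmlookup_dom_iff)
  have "\<exists>Q'. proj G r Q' \<and> (N(q := P)) r \<preceq> Q'" for r
  proof (cases "r = q")
    case True
    then show ?thesis using Q(1) D(3) by auto
  next
    case False
    then show ?thesis using pr[of r] proj_other_GInp False by fastforce
  qed
  then have "conforms (N(q := P)) M' G"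
    using global_type_gchild[OF gt gchild_GInp] M'(2) by (simp add: conforms_def)
  then show ?thesis using step_recv[of N q p D l P M'] D(1,2) M'(1) by blast
qed

section \<open>Execution sequences and progress\<close>

lemma steps_snoc_cons:
  "step c \<beta>' c' \<Longrightarrow> steps c' (\<tau> @ [\<beta>]) c'' \<Longrightarrow> steps c ((\<beta>' # \<tau>) @ [\<beta>]) c''"
  by (simp add: steps_cons)

lemma steps_single: "step c \<beta> c' \<Longrightarrow> steps c ([] @ [\<beta>]) c'"
  by (simp add: steps_cons steps_nil)

text \<open>A derivation of \<open>in_play p G\<close> is a finite path to a communication of
  \<open>p\<close>, so induction on it works even if the tree of \<open>G\<close> is
  infinite.\<close>

lemma participant_progress:
  assumes "in_play p G" "conforms N M G"
  shows "\<exists>\<tau> \<beta> N' M'. comm_play \<beta> = {p} \<and> steps (N, M) (\<tau> @ [\<beta>]) (N', M')"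
  using assms
proof (induction arbitrary: N M rule: in_play.induct)
  case (1 p q B)
  then obtain l G where "fmlookup B l = Some G"
    by (auto simp: conforms_def elim: global_type_GOut_label)
  then obtain N' where "step (N, M) (Send p q l) (N', M \<cdot> qmsg p l q)"
    using conforms_GOut_step[OF 1] by blast
  then show ?case using steps_single by (metis comm_play.simps(1))
next
  case (2 B l G r p q)
  obtain N' where N': "step (N, M) (Send p q l) (N', M \<cdot> qmsg p l q)"
    "conforms N' (M \<cdot> qmsg p l q) G"
    using conforms_GOut_step[OF 2(4) 2(1)] by blast
  from 2(3)[OF N'(2)] show ?case using steps_snoc_cons[OF N'(1)] by blast
next
  case (3 q p l G)
  then obtain N' M' where "step (N, M) (Recv p q l) (N', M')"
    using conforms_GInp_step[OF 3] by blast
  then show ?case using steps_single by (metis comm_play.simps(2))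
next
  case (4 r G p q l)
  obtain N' M' where N': "step (N, M) (Recv p q l) (N', M')" "conforms N' M' G"
    using conforms_GInp_step[OF 4(3)] by blast
  from 4(2)[OF N'(2)] show ?case using steps_snoc_cons[OF N'(1)] by blast
qed

lemma message_progress:
  assumes "conforms N (qmsg p l q \<cdot> M) G"
  shows "\<exists>\<tau> N' M'. steps (N, qmsg p l q \<cdot> M) (\<tau> @ [Recv p q l]) (N', M')"
  using assms
\<comment> \<open>The subtree count comes first: an output lengthens the queue but, being non-cyclic
  here, lowers the count. An input never raises the count and shortens the queue.\<close>
proof (induction "(card (subtrees G), qlength (qmsg p l q \<cdot> M))" arbitrary: N M G
    rule: wf_induct_rule[OF wf_lex_prod[OF wf_less_than wf_less_than]])
  case 1
  let ?M = "qmsg p l q \<cdot> M"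
  have gt: "global_type G" and bal: "balanced G ?M"
    using 1(2) by (auto simp: conforms_def)
  show ?case
  proof (cases G)
    case End
    with bal have "?M = qempty" by (auto elim: balanced.cases)
    then show ?thesis by (simp add: qmsg_append_neq_qempty)
  next
    case (GOut r s B)
    then obtain k H where k: "fmlookup B k = Some H"
      using gt by (auto elim: global_type_GOut_label)
    have "\<not> cyclic G"
      using bal qmsg_append_neq_qempty[of p l q M] GOut by (auto elim: balanced.cases)
    then have "card (subtrees H) < card (subtrees G)"
      using card_subtrees_gchild(2) gt gchild_GOut[OF k] GOut by blast
    moreover obtain N' where "step (N, ?M) (Send r s k) (N', ?M \<cdot> qmsg r k s)"
      "conforms N' (?M \<cdot> qmsg r k s) H"
      using conforms_GOut_step[of N ?M r s B k H] k 1(2) GOut by blast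
    \<comment> \<open>The awaited message stays at the head: after reassociation
      \<open>M \<cdot> qmsg r k s\<close> is the rest of the queue.\<close>
    moreover from calculation have
      "\<exists>\<tau> N'' M''. steps (N', ?M \<cdot> qmsg r k s) (\<tau> @ [Recv p q l]) (N'', M'')"
      using 1(1)[of H "M \<cdot> qmsg r k s" N'] by (simp add: qappend_assoc)
    ultimately show ?thesis using steps_snoc_cons by blast
  next
    case (GInp r s k H)
    obtain N' M' where M': "?M = qmsg r k s \<cdot> M'" "step (N, ?M) (Recv r s k) (N', M')"
      "conforms N' M' H"
      using conforms_GInp_step[of N ?M r s k H] 1(2) GInp by blast
    from two_heads[OF M'(1)] show ?thesis
    proof (elim disjE exE conjE)
      assume "p = r" "q = s" "l = k"
      then show ?thesis using M'(2) steps_single by blast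
    next
      fix M'' assume M'': "M' = qmsg p l q \<cdot> M''"
      have "qlength ?M = Suc (qlength M')" using M'(1) by (simp add: qlength_msg_append)
      moreover have "card (subtrees H) \<le> card (subtrees G)"
        using card_subtrees_gchild(1)[OF gt] gchild_GInp[of r s k H] GInp by blast
      ultimately have "\<exists>\<tau> N'' M'''. steps (N', M') (\<tau> @ [Recv p q l]) (N'', M''')"
        using 1(1)[of H M'' N'] M'(3) M'' by (auto simp: le_less)
      then show ?thesis using M'(2) steps_snoc_cons by blast
    qed
  qed
qed

text \<open>Outside \<open>play G\<close> the projection is \<open>Inact\<close>, and only
  \<open>Inact\<close> lies below \<open>Inact\<close>.\<close>

lemma conforms_in_play:
  assumes "conforms N M G" "N p \<noteq> Inact"
  shows "in_play p G"
proof (rule ccontr)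
  assume "\<not> in_play p G"
  then have "p \<notin> play G" by (simp add: play_def)
  moreover obtain Q where Q: "proj G p Q" "N p \<preceq> Q" using assms(1) by (auto simp: conforms_def)
  ultimately have "Q = Inact" using proj_outside_play[of G p Q] by simp
  with Q(2) show False using assms(2) by (auto elim: proc_le.cases)
qed

theorem theorem3p19:
  fixes N :: "('p, 'l) net" and M :: "('p, 'l) queue"
  assumes "\<exists>G. typed N M G"
  shows "(\<forall>p P. in_net p P N \<longrightarrow>
            (\<exists>\<tau> \<beta> N' M'. comm_play \<beta> = {p} \<and> steps (N, M) (\<tau> @ [\<beta>]) (N', M'))) \<and>
         (\<forall>p l q M\<^sub>1. M = qmsg p l q \<cdot> M\<^sub>1 \<longrightarrow>
            (\<exists>\<tau> N' M'. steps (N, M) (\<tau> @ [Recv p q l]) (N', M')))"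
proof (intro conjI allI impI)
  from assms obtain G where conf: "conforms N M G" using typed_conforms by blast
  show "\<exists>\<tau> \<beta> N' M'. comm_play \<beta> = {p} \<and> steps (N, M) (\<tau> @ [\<beta>]) (N', M')"
    if "in_net p P N" for p P
  proof -
    have "N p \<noteq> Inact" using that unfolding in_net_def by (metis fun_upd_same)
    then show ?thesis by (rule participant_progress[OF conforms_in_play[OF conf] conf])
  qed
  show "\<exists>\<tau> N' M'. steps (N, M) (\<tau> @ [Recv p q l]) (N', M')"
    if "M = qmsg p l q \<cdot> M\<^sub>1" for p l q M\<^sub>1
    using message_progress conf unfolding that .
qed

end
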